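(* Let $X$ be a connected finite digital image. If $\#X = 2$ then $F(X) = \{0,1,2\}$. If $\#X > 2$, then $\{0,1,2,3,\#X\} \subseteq F(X)$.
   Context: A digital image is a pair $(X,\kappa)$, where $X\subset\mathbb{Z}^m$ for some $m$ and $\kappa$ is an adjacency (a symmetric, irreflexive relation) on $X$; thus it is a simple graph with vertex set $X$, and "connected" means connected as a graph. A function $f:X\to Y$ between digital images is continuous if whenever $x,y$ are adjacent in $X$, $f(x),f(y)$ are adjacent or equal in $Y$. $\mathrm{Fix}(f)=\{x\in X\mid f(x)=x\}$, and $\#$ denotes the number of elements of a set. The fixed point spectrum of $X$ is $F(X)=\{\#\mathrm{Fix}(f)\mid f:X\to X\text{ is continuous}\}$. *)

theory Defs
  imports "HOL-Analysis.Finite_Cartesian_Product" "HOL-Library.FuncSet"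
begin

definition digital_image :: "(int ^ 'm) set \<Rightarrow> (int ^ 'm) rel \<Rightarrow> bool" where
  "digital_image X \<kappa> \<longleftrightarrow> \<kappa> \<subseteq> X \<times> X \<and> sym \<kappa> \<and> irrefl \<kappa>"

(* Paths stay inside X because an adjacency on X satisfies \<kappa> \<subseteq> X \<times> X. *)
definition digitally_connected :: "(int ^ 'm) set \<Rightarrow> (int ^ 'm) rel \<Rightarrow> bool" where
  "digitally_connected X \<kappa> \<longleftrightarrow> (\<forall>x\<in>X. \<forall>y\<in>X. (x, y) \<in> \<kappa>\<^sup>*)"

definition digitally_continuous ::
  "(int ^ 'm) set \<Rightarrow> (int ^ 'm) rel \<Rightarrow> (int ^ 'n) set \<Rightarrow> (int ^ 'n) rel
     \<Rightarrow> (int ^ 'm \<Rightarrow> int ^ 'n) \<Rightarrow> bool" where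
  "digitally_continuous X \<kappa> Y \<mu> f \<longleftrightarrow>
     f \<in> X \<rightarrow> Y \<and> (\<forall>x\<in>X. \<forall>y\<in>X. (x, y) \<in> \<kappa> \<longrightarrow> (f x, f y) \<in> \<mu> \<or> f x = f y)"

definition Fix :: "(int ^ 'm) set \<Rightarrow> (int ^ 'm \<Rightarrow> int ^ 'm) \<Rightarrow> (int ^ 'm) set" where
  "Fix X f = {x \<in> X. f x = x}"

(* Meaningful for finite X only, since card of an infinite set is 0. The values of f
   outside X are irrelevant: neither continuity nor Fix inspects them. *)
definition fixed_point_spectrum :: "(int ^ 'm) set \<Rightarrow> (int ^ 'm) rel \<Rightarrow> nat set" where
  "fixed_point_spectrum X \<kappa> = {card (Fix X f) | f. digitally_continuous X \<kappa> X \<kappa> f}"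

end

theory Submission
  imports Defs
begin

text \<open>If \<open>b \<in> S\<close> and every other point of \<open>S\<close> is adjacent to \<open>b\<close>, then the map that fixes \<open>S\<close>
  and collapses the rest of \<open>X\<close> to \<open>b\<close> is continuous: an edge inside \<open>S\<close> is preserved, and any
  other edge has an endpoint sent to \<open>b\<close>, hence image in the star of \<open>b\<close>. Stars with one, two and
  three points thus give the values 1, 2 and 3. Sending one endpoint of an edge to the other, and
  everything else back to the first, leaves no fixed point.\<close>

lemma fixed_point_spectrumI:
  "digitally_continuous X \<kappa> X \<kappa> f \<Longrightarrow> Fix X f = S \<Longrightarrow> card S \<in> fixed_point_spectrum X \<kappa>"
  unfolding fixed_point_spectrum_def by blast

lemma fixed_point_spectrum_le_card:
  assumes "finite X" and "k \<in> fixed_point_spectrum X \<kappa>"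
  shows "k \<le> card X"
proof -
  obtain f where "k = card (Fix X f)"
    using assms(2) unfolding fixed_point_spectrum_def by blast
  moreover have "Fix X f \<subseteq> X"
    unfolding Fix_def by blast
  ultimately show ?thesis
    using assms(1) by (simp add: card_mono)
qed

lemma card_in_fixed_point_spectrum: "card X \<in> fixed_point_spectrum X \<kappa>"
proof (rule fixed_point_spectrumI)
  show "digitally_continuous X \<kappa> X \<kappa> id"
    unfolding digitally_continuous_def by simp
qed (simp add: Fix_def)

lemma card_star_in_fixed_point_spectrum:
  assumes "sym \<kappa>" and "S \<subseteq> X" and "b \<in> S"
    and star: "\<And>s. s \<in> S \<Longrightarrow> s \<noteq> b \<Longrightarrow> (b, s) \<in> \<kappa>"
  shows "card S \<in> fixed_point_spectrum X \<kappa>"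
proof (rule fixed_point_spectrumI)
  let ?f = "\<lambda>x. if x \<in> S then x else b"
  \<comment> \<open>For an edge from \<open>s\<close> in \<open>S\<close> to a point outside, the
    image is \<open>(s, b)\<close>, while \<open>star\<close> only supplies \<open>(b, s)\<close>;
    this is where symmetry enters.\<close>
  show "digitally_continuous X \<kappa> X \<kappa> ?f"
    unfolding digitally_continuous_def
    using assms by (auto dest: symD)
  show "Fix X ?f = S"
    unfolding Fix_def using assms(2,3) by auto
qed

lemma zero_in_fixed_point_spectrum:
  assumes "digital_image X \<kappa>" and "(a, b) \<in> \<kappa>"
  shows "0 \<in> fixed_point_spectrum X \<kappa>"
proof -
  let ?f = "\<lambda>x. if x = a then b else a"
  have "a \<noteq> b" "(b, a) \<in> \<kappa>" "a \<in> X" "b \<in> X"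
    using assms unfolding digital_image_def by (auto simp: irrefl_def dest: symD)
  \<comment> \<open>All values lie in \<open>{a, b}\<close>, whose points are adjacent in both
    directions, so any such map is continuous.\<close>
  then have "digitally_continuous X \<kappa> X \<kappa> ?f" and "Fix X ?f = {}"
    using assms(2) unfolding digitally_continuous_def Fix_def by auto
  from fixed_point_spectrumI[OF this] show ?thesis
    by simp
qed

text \<open>Otherwise \<open>S\<close> would be closed under \<open>\<kappa>\<close>, hence under
  paths, and could not miss a point of \<open>X\<close>. Taking \<open>S\<close> to be one point
  yields an edge; taking the ends of that edge yields a third point attached to it.\<close>

lemma digitally_connected_edge_leaving:
  assumes "digitally_connected X \<kappa>" and "S \<subset> X" and "S \<noteq> {}"
  obtains u w where "u \<in> S" and "w \<notin> S" and "(u, w) \<in> \<kappa>"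
proof -
  obtain x y where "x \<in> S" "y \<in> X" "y \<notin> S"
    using assms(2,3) by blast
  moreover have "(x, y) \<in> \<kappa>\<^sup>*"
    using assms(1,2) calculation unfolding digitally_connected_def by blast
  ultimately have "\<not> \<kappa> `` S \<subseteq> S"
    using Image_closed_trancl by blast
  then show thesis
    using that by blast
qed

theorem corollary4p7:
  fixes X :: "(int ^ 'm) set" and \<kappa> :: "(int ^ 'm) rel"
  assumes "digital_image X \<kappa>"
    and "finite X"
    and "digitally_connected X \<kappa>"
  shows "(card X = 2 \<longrightarrow> fixed_point_spectrum X \<kappa> = {0, 1, 2}) \<and>
         (card X > 2 \<longrightarrow> {0, 1, 2, 3, card X} \<subseteq> fixed_point_spectrum X \<kappa>)"
proof (cases "card X \<ge> 2")
  case True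
  have sub: "\<kappa> \<subseteq> X \<times> X" and sym: "sym \<kappa>" and irrefl: "irrefl \<kappa>"
    using assms(1) unfolding digital_image_def by auto
  obtain x where "x \<in> X"
    using True by fastforce
  moreover have "X \<noteq> {x}"
    using True by auto
  ultimately obtain a b where ab: "(a, b) \<in> \<kappa>"
    using digitally_connected_edge_leaving[OF assms(3), of "{x}"] by blast
  have X: "a \<in> X" "b \<in> X" and ne: "a \<noteq> b"
    using ab sub irrefl by (auto simp: irrefl_def)
  have zero: "0 \<in> fixed_point_spectrum X \<kappa>"
    using zero_in_fixed_point_spectrum[OF assms(1) ab] .
  have one: "1 \<in> fixed_point_spectrum X \<kappa>"
    using card_star_in_fixed_point_spectrum[OF sym, of "{a}" X a] X by simp
  have two: "2 \<in> fixed_point_spectrum X \<kappa>"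
    using card_star_in_fixed_point_spectrum[OF sym, of "{a, b}" X a] X ab ne by (auto simp: numeral_2_eq_2)
  have three: "3 \<in> fixed_point_spectrum X \<kappa>" if "card X > 2"
  proof -
    have "{a, b} \<subset> X"
      using X ne that by auto
    then obtain u w where uw: "u \<in> {a, b}" "w \<notin> {a, b}" "(u, w) \<in> \<kappa>"
      using digitally_connected_edge_leaving[OF assms(3)] by blast
    have "w \<in> X"
      using uw(3) sub by blast
    have "card {a, b, w} = 3"
      using ne uw(2) by (auto simp: card_insert_if)
    moreover have "card {a, b, w} \<in> fixed_point_spectrum X \<kappa>"
    proof (rule card_star_in_fixed_point_spectrum[OF sym])
      show "{a, b, w} \<subseteq> X" "u \<in> {a, b, w}"
        using X \<open>w \<in> X\<close> uw(1) by auto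
      \<comment> \<open>The centre is whichever end of the edge \<open>(a, b)\<close> is joined to
        \<open>w\<close>; the other end is its neighbour through that edge, reversed if
        \<open>u = b\<close>.\<close>
      show "(u, s) \<in> \<kappa>" if "s \<in> {a, b, w}" "s \<noteq> u" for s
        using that uw ab symD[OF sym ab] by auto
    qed
    ultimately show ?thesis
      by (simp only:)
  qed
  have "k \<in> {0, 1, 2}" if "k \<in> fixed_point_spectrum X \<kappa>" "card X = 2" for k
    using fixed_point_spectrum_le_card[OF assms(2) that(1)] that(2) by auto
  then show ?thesis
    using zero one two three card_in_fixed_point_spectrum[of X \<kappa>] by blast
\<comment> \<open>With fewer than two points both implications are vacuous.\<close>
qed simp

end
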